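(* Let $1\le r\le N$ and let $\mathcal{G}_r(N)=\{X\in\mathbb{R}^{N\times N}:X^\top=X,\ X^2=X,\ \mathrm{tr}(X)=r\}$ be the Grassmann manifold. Given a density $p>0$ and a kernel $\kappa>0$ of class $C^{(1,1)}$ on $\mathcal{G}_r(N)$, the function $\kappa_p$ is given by $$\kappa_p(X,Y)=4\langle\mathscr{A}(\nabla^{\mathbb{R}}_X\log(p\kappa)X),\mathscr{A}(\nabla^{\mathbb{R}}_Y\log(p\kappa)Y)\rangle_F\,\kappa(X,Y)+\sum_{i<j}K^{ij}_YK^{ij}_X\log\kappa\cdot\kappa(X,Y),$$ where all Euclidean gradients are chosen to be symmetric matrices. Furthermore, if $\kappa(X,Y)=e^{-\psi(\|X-Y\|_F^2)}$ is a radial kernel for some $\psi\in C^2[0,+\infty)$, then $$\begin{aligned}\kappa_p(X,Y)&=4\langle\mathscr{A}(\nabla^{\mathbb{R}}_X\log(p\kappa)X),\mathscr{A}(\nabla^{\mathbb{R}}_Y\log(p\kappa)Y)\rangle_F\,\kappa(X,Y)\\&\quad+2\psi'(\|X-Y\|_F^2)\,(N\langle X,Y\rangle_F-r^2)\,\kappa(X,Y)\\&\quad+4\psi''(\|X-Y\|_F^2)\,\|XY-YX\|_F^2\,\kappa(X,Y).\end{aligned}$$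
   Context: $\langle A,B\rangle_F=\mathrm{tr}(A^\top B)$ is the Frobenius inner product, $\|\cdot\|_F$ its norm, and $\mathscr{A}(A)=(A-A^\top)/2$. $E_{ij}$ is the $N\times N$ matrix with a $1$ in entry $(i,j)$ and zeros elsewhere, and $\mathcal{E}_{ij}=\frac{\sqrt2}{2}(E_{ij}-E_{ji})$ for $1\le i<j\le N$. The orthogonal group $O(N)$ acts on $\mathcal{G}_r(N)$ by $O.X=OXO^\top$, and the killing field corresponding to $\mathcal{E}_{ij}$ is $K^{ij}_X=\mathcal{E}_{ij}X-X\mathcal{E}_{ij}\in T_X\mathcal{G}_r(N)$. A kernel is real-valued, symmetric, positive semi-definite; $C^{(1,1)}$ means once continuously differentiable in each argument with continuous mixed derivative of order $(1,1)$. For a bivariate function, $K^{ij}_X$, $K^{ij}_Y$ denote $K^{ij}$ acting on the first argument $X$ and second argument $Y$. The function $\kappa_p$ is defined by $$\kappa_p(X,Y)=\kappa(X,Y)\sum_{i<j}\left[K^{ij}_X\log(p(X)\kappa(X,Y))\cdot K^{ij}_Y\log(p(Y)\kappa(X,Y))+K^{ij}_YK^{ij}_X\log\kappa(X,Y)\right].$$ The density $p$ is locally Lipschitz; derivatives of $\log p$ are set to $0$ at points of non-differentiability. For a function $f$ on a submanifold $M\subset\mathbb{R}^{N\times N}$ differentiable at $X$, a Euclidean gradient $\nabla^{\mathbb{R}}_Xf$ is any matrix in $\mathbb{R}^{N\times N}$ with $D_Xf=\langle\nabla^{\mathbb{R}}_Xf,D_X\rangle_F$ for all $D_X\in T_XM\subset\mathbb{R}^{N\times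 N}$ (not unique). $\nabla^{\mathbb{R}}_X\log(p\kappa)$ is the gradient of $X\mapsto\log(p(X)\kappa(X,Y))$ with $Y$ fixed, and similarly $\nabla^{\mathbb{R}}_Y\log(p\kappa)$ is that of $Y\mapsto\log(p(Y)\kappa(X,Y))$ with $X$ fixed. *)

theory Defs
  imports "HOL-Analysis.Analysis"
begin

type_synonym 'n sqmat = "real^'n^'n"

definition frob_inner :: "('n::finite) sqmat \<Rightarrow> 'n sqmat \<Rightarrow> real" where
  "frob_inner A B = trace (transpose A ** B)"

definition frob_norm :: "('n::finite) sqmat \<Rightarrow> real" where
  "frob_norm A = sqrt (frob_inner A A)"

lemma frob_inner_eq_inner: "frob_inner A B = A \<bullet> B"
proof -
  have "frob_inner A B = (\<Sum>i\<in>UNIV. \<Sum>k\<in>UNIV. A $ k $ i * B $ k $ i)"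
    by (simp add: frob_inner_def trace_def transpose_def matrix_matrix_mult_def)
  also have "\<dots> = (\<Sum>k\<in>UNIV. \<Sum>i\<in>UNIV. A $ k $ i * B $ k $ i)"
    by (rule sum.swap)
  also have "\<dots> = A \<bullet> B"
    by (simp add: inner_vec_def)
  finally show ?thesis .
qed

lemma frob_norm_eq_norm: "frob_norm A = norm A"
  by (simp add: frob_norm_def frob_inner_eq_inner norm_eq_sqrt_inner)

definition skew_part :: "('n::finite) sqmat \<Rightarrow> 'n sqmat" where
  "skew_part A = (1/2) *\<^sub>R (A - transpose A)"

definition symmetric_mat :: "('n::finite) sqmat \<Rightarrow> bool" where
  "symmetric_mat A \<longleftrightarrow> transpose A = A"

definition mat_unit :: "'n \<Rightarrow> 'n \<Rightarrow> ('n::finite) sqmat" where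
  "mat_unit i j = (\<chi> k l. if k = i \<and> l = j then 1 else 0)"

definition skew_unit :: "'n \<Rightarrow> 'n \<Rightarrow> ('n::finite) sqmat" where
  "skew_unit i j = (sqrt 2 / 2) *\<^sub>R (mat_unit i j - mat_unit j i)"

definition grassmann :: "nat \<Rightarrow> ('n::finite) sqmat set" where
  "grassmann r = {X. transpose X = X \<and> X ** X = X \<and> trace X = real r}"

text \<open>Calculus on an embedded submanifold \<open>M\<close> of a Euclidean space. A function on \<open>M\<close> is a
  function on the ambient space of which only the values on \<open>M\<close> matter, and it is
  differentiable at \<open>X\<close> as a function on \<open>M\<close> iff it is differentiable at \<open>X\<close> within \<open>M\<close>.
  Tangent vectors are the velocities of \<open>C\<^sup>1\<close> curves in \<open>M\<close>.\<close>

definition tangent_space :: "'a::real_normed_vector set \<Rightarrow> 'a \<Rightarrow> 'a set" where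
  "tangent_space M X = {V. \<exists>\<gamma> \<epsilon>. \<epsilon> > 0 \<and> \<gamma> C1_differentiable_on {-\<epsilon><..<\<epsilon>} \<and>
      \<gamma> ` {-\<epsilon><..<\<epsilon>} \<subseteq> M \<and> \<gamma> 0 = X \<and> (\<gamma> has_vector_derivative V) (at 0)}"

text \<open>The derivative of \<open>f\<close> along \<open>V\<close>. A derivative within \<open>M\<close> is not unique as a
  linear map on the ambient space, but its values on tangent vectors are; the definition is
  meant only for \<open>f\<close> differentiable at \<open>X\<close> within \<open>M\<close> and \<open>V\<close> in the tangent space.\<close>

definition tangent_deriv ::
    "'a::real_normed_vector set \<Rightarrow> ('a \<Rightarrow> real) \<Rightarrow> 'a \<Rightarrow> 'a \<Rightarrow> real" where
  "tangent_deriv M f X V = frechet_derivative f (at X within M) V"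

definition euclidean_gradient ::
    "('n::finite) sqmat set \<Rightarrow> ('n sqmat \<Rightarrow> real) \<Rightarrow> 'n sqmat \<Rightarrow> 'n sqmat \<Rightarrow> bool" where
  "euclidean_gradient M f X G \<longleftrightarrow> f differentiable (at X within M) \<and>
     (\<forall>V \<in> tangent_space M X. tangent_deriv M f X V = frob_inner G V)"

definition locally_lipschitz_on :: "'a::metric_space set \<Rightarrow> ('a \<Rightarrow> real) \<Rightarrow> bool" where
  "locally_lipschitz_on M p \<longleftrightarrow>
     (\<forall>X\<in>M. \<exists>\<delta>>0. \<exists>L. L-lipschitz_on (ball X \<delta> \<inter> M) p)"

text \<open>\<open>D1\<close>, \<open>D2\<close> are the derivatives in the first and second argument and \<open>D12\<close> is the
  derivative of \<open>D1\<close> in the second argument, all jointly continuous. Only the restrictions to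
  tangent vectors are determined by \<open>\<kappa>\<close>; on an embedded submanifold, extending them by the
  orthogonal projections onto the tangent spaces shows that this agrees with the definition
  in charts.\<close>

definition C11_on ::
    "'a::euclidean_space set \<Rightarrow> ('a \<Rightarrow> 'a \<Rightarrow> real) \<Rightarrow> bool" where
  "C11_on M \<kappa> \<longleftrightarrow>
     (\<exists>(D1 :: 'a \<Rightarrow> 'a \<Rightarrow> 'a \<Rightarrow>\<^sub>L real) (D2 :: 'a \<Rightarrow> 'a \<Rightarrow> 'a \<Rightarrow>\<^sub>L real)
        (D12 :: 'a \<Rightarrow> 'a \<Rightarrow> 'a \<Rightarrow>\<^sub>L ('a \<Rightarrow>\<^sub>L real)).
        (\<forall>X\<in>M. \<forall>Y\<in>M.
           ((\<lambda>Z. \<kappa> Z Y) has_derivative blinfun_apply (D1 X Y)) (at X within M) \<and>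
           ((\<lambda>Z. \<kappa> X Z) has_derivative blinfun_apply (D2 X Y)) (at Y within M) \<and>
           ((\<lambda>Z. D1 X Z) has_derivative blinfun_apply (D12 X Y)) (at Y within M)) \<and>
        continuous_on (M \<times> M) (\<lambda>(X, Y). D1 X Y) \<and>
        continuous_on (M \<times> M) (\<lambda>(X, Y). D2 X Y) \<and>
        continuous_on (M \<times> M) (\<lambda>(X, Y). D12 X Y))"

definition kernel_on :: "'a set \<Rightarrow> ('a \<Rightarrow> 'a \<Rightarrow> real) \<Rightarrow> bool" where
  "kernel_on M \<kappa> \<longleftrightarrow>
     (\<forall>X\<in>M. \<forall>Y\<in>M. \<kappa> X Y = \<kappa> Y X) \<and>
     (\<forall>F c. finite F \<and> F \<subseteq> M \<longrightarrow> 0 \<le> (\<Sum>X\<in>F. \<Sum>Y\<in>F. c X * c Y * \<kappa> X Y))"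

text \<open>The Riemannian volume of the Grassmann manifold is characterised up to a constant factor
  as the nonzero finite Borel measure invariant under the (transitive) action of the
  orthogonal group by conjugation.\<close>

definition grassmann_volume :: "nat \<Rightarrow> ('n::finite) sqmat measure \<Rightarrow> bool" where
  "grassmann_volume r \<mu> \<longleftrightarrow>
     sets \<mu> = sets (restrict_space borel (grassmann r)) \<and>
     0 < emeasure \<mu> (space \<mu>) \<and> emeasure \<mu> (space \<mu>) < \<infinity> \<and>
     (\<forall>Q. orthogonal_matrix Q \<longrightarrow> distr \<mu> \<mu> (\<lambda>X. Q ** X ** transpose Q) = \<mu>)"

definition killing_field :: "'n \<Rightarrow> 'n \<Rightarrow> ('n::finite) sqmat \<Rightarrow> 'n sqmat" where
  "killing_field i j X = skew_unit i j ** X - X ** skew_unit i j"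

definition killing_deriv ::
    "nat \<Rightarrow> 'n \<Rightarrow> 'n \<Rightarrow> (('n::finite) sqmat \<Rightarrow> real) \<Rightarrow> 'n sqmat \<Rightarrow> real" where
  "killing_deriv r i j f X = tangent_deriv (grassmann r) f X (killing_field i j X)"

text \<open>The function \<open>Z \<mapsto> log (p(Z) f(Z))\<close>, to be differentiated at \<open>X\<close>. The
  convention that derivatives of \<open>log p\<close> are \<open>0\<close> where \<open>log p\<close> is not differentiable amounts to
  dropping the term \<open>log p\<close> if it is not differentiable at \<open>X\<close>.\<close>

definition log_dens ::
    "nat \<Rightarrow> (('n::finite) sqmat \<Rightarrow> real) \<Rightarrow> ('n sqmat \<Rightarrow> real) \<Rightarrow> 'n sqmat \<Rightarrow> 'n sqmat \<Rightarrow> real" where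
  "log_dens r p f X =
     (if (\<lambda>Z. ln (p Z)) differentiable (at X within grassmann r)
      then (\<lambda>Z. ln (p Z * f Z)) else (\<lambda>Z. ln (f Z)))"

text \<open>The mixed term \<open>K\<^sup>i\<^sup>j\<^sub>Y K\<^sup>i\<^sup>j\<^sub>X log \<kappa>\<close>: first differentiate in the first argument at \<open>X\<close>,
  then in the second argument at \<open>Y\<close>.\<close>

definition killing_mixed ::
    "nat \<Rightarrow> 'n \<Rightarrow> 'n \<Rightarrow> (('n::finite) sqmat \<Rightarrow> 'n sqmat \<Rightarrow> real) \<Rightarrow> 'n sqmat \<Rightarrow> 'n sqmat \<Rightarrow> real" where
  "killing_mixed r i j \<kappa> X Y =
     killing_deriv r i j (\<lambda>W. killing_deriv r i j (\<lambda>Z. ln (\<kappa> Z W)) X) Y"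

text \<open>The index type is linearly ordered only to make sense of sums over \<open>i < j\<close>.\<close>

definition kappa_p ::
    "nat \<Rightarrow> (('n::{finite,linorder}) sqmat \<Rightarrow> real) \<Rightarrow> ('n sqmat \<Rightarrow> 'n sqmat \<Rightarrow> real)
       \<Rightarrow> 'n sqmat \<Rightarrow> 'n sqmat \<Rightarrow> real" where
  "kappa_p r p \<kappa> X Y = \<kappa> X Y *
     (\<Sum>(i, j) | i < j.
        killing_deriv r i j (log_dens r p (\<lambda>Z. \<kappa> Z Y) X) X *
        killing_deriv r i j (log_dens r p (\<lambda>Z. \<kappa> X Z) Y) Y +
        killing_mixed r i j \<kappa> X Y)"

end

theory Submission
  imports Defs
begin

text \<open>Rotating \<open>X\<close> in a coordinate plane gives a curve in the Grassmannian with velocity the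
  Killing field \<open>K\<close>, so every derivative along \<open>K\<close> is the pairing of a gradient with \<open>K\<close>. For
  symmetric \<open>G\<close> and \<open>X\<close> that pairing is the coefficient of the skew matrix \<open>GX - XG\<close> along a
  member of the orthonormal basis \<open>skew_unit i j\<close>, \<open>i < j\<close>, of the skew matrices, and the first
  formula is Parseval's identity. In the radial case \<open>X\<close> is orthogonal to \<open>K\<^sub>X\<close>, so differentiating
  \<open>-\<psi>(\<parallel>X - Y\<parallel>\<^sup>2)\<close> twice leaves \<open>2 \<psi>' \<langle>K\<^sub>X, K\<^sub>Y\<rangle> - 4 \<psi>'' \<langle>K\<^sub>X, Y\<rangle> \<langle>X, K\<^sub>Y\<rangle>\<close>; the second term is
  summed by Parseval for the commutator of \<open>X\<close> and \<open>Y\<close>, the first by computing entries.\<close>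

section \<open>Derivatives along tangent vectors\<close>

text \<open>A derivative within \<open>M\<close> need not be unique as a linear map, and
  \<open>frechet_derivative\<close> chooses one. Along a curve in \<open>M\<close> with velocity
  \<open>V\<close>, every choice yields the derivative of \<open>f \<circ> \<gamma>\<close> at 0,
  which is unique; hence any known \<open>D\<close> may be used.\<close>

lemma has_tangent_deriv:
  assumes f: "(f has_derivative D) (at X within M)" and V: "V \<in> tangent_space M X"
  shows "tangent_deriv M f X V = D V"
proof -
  obtain \<gamma> \<epsilon> where e: "\<epsilon> > 0" and img: "\<gamma> ` {-\<epsilon><..<\<epsilon>} \<subseteq> M" and g0: "\<gamma> 0 = X"
    and d: "(\<gamma> has_vector_derivative V) (at 0)"
    using V unfolding tangent_space_def by blast
  have deriv: "((f \<circ> \<gamma>) has_vector_derivative L V) (at 0)"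
    if L: "(f has_derivative L) (at X within M)" for L
  proof -
    have "(f has_derivative L) (at (\<gamma> 0) within \<gamma> ` {-\<epsilon><..<\<epsilon>})"
      using has_derivative_subset[OF L img] by (simp add: g0)
    from vector_derivative_diff_chain_within[OF has_vector_derivative_at_within[OF d] this]
    have "((f \<circ> \<gamma>) has_vector_derivative L V) (at 0 within {-\<epsilon><..<\<epsilon>})" .
    moreover have "at 0 within {-\<epsilon><..<\<epsilon>} = at 0"
      using e by (intro at_within_open) auto
    ultimately show ?thesis by (simp only:)
  qed
  have "(f has_derivative frechet_derivative f (at X within M)) (at X within M)"
    using frechet_derivative_works[of f] differentiableI[OF f] by simp
  from deriv[OF this] deriv[OF f] show ?thesis
    unfolding tangent_deriv_def by (rule vector_derivative_unique_at)
qed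

section \<open>Matrix units and bilinearity of the matrix product\<close>

lemma mat_unit_mult_nth [simp]:
  "(mat_unit i j ** A) $ k $ l = (if k = i then A $ j $ l else 0)"
proof -
  have "(mat_unit i j ** A) $ k $ l = (\<Sum>m\<in>UNIV. if m = j then (if k = i then A $ j $ l else 0) else 0)"
    unfolding matrix_matrix_mult_def mat_unit_def vec_lambda_beta by (intro sum.cong refl) auto
  then show ?thesis by simp
qed

lemma mult_mat_unit_nth [simp]:
  "(A ** mat_unit i j) $ k $ l = (if l = j then A $ k $ i else 0)"
proof -
  have "(A ** mat_unit i j) $ k $ l = (\<Sum>m\<in>UNIV. if m = i then (if l = j then A $ k $ i else 0) else 0)"
    unfolding matrix_matrix_mult_def mat_unit_def vec_lambda_beta by (intro sum.cong refl) auto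
  then show ?thesis by simp
qed

lemma mat_unit_mult_mat_unit: "mat_unit i j ** mat_unit k l = (if j = k then mat_unit i l else 0)"
  by (simp add: vec_eq_iff) (simp add: mat_unit_def)

lemma inner_mat_unit [simp]: "A \<bullet> mat_unit i j = A $ i $ j"
proof -
  have "A \<bullet> mat_unit i j = (\<Sum>k\<in>UNIV. \<Sum>l\<in>UNIV. if l = j then (if k = i then A $ i $ j else 0) else 0)"
    unfolding inner_vec_def mat_unit_def vec_lambda_beta by (intro sum.cong refl) auto
  then show ?thesis by simp
qed

lemma inner_skew_unit: "A \<bullet> skew_unit i j = sqrt 2 / 2 * (A $ i $ j - A $ j $ i)"
  by (simp add: skew_unit_def inner_diff_right)

lemma transpose_mat_unit: "transpose (mat_unit i j) = mat_unit j i"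
  by (auto simp: transpose_def mat_unit_def vec_eq_iff)

text \<open>In finite dimension bilinearity implies boundedness. The interpretation below then
  provides the product rule and continuity for matrix-valued curves.\<close>

lemma bounded_bilinear_matrix_mult:
  "bounded_bilinear ((**) :: ('n::finite) sqmat \<Rightarrow> 'n sqmat \<Rightarrow> 'n sqmat)"
proof -
  have "bilinear ((**) :: 'n sqmat \<Rightarrow> 'n sqmat \<Rightarrow> 'n sqmat)"
    unfolding bilinear_def
    by (auto intro!: linearI simp: matrix_matrix_mult_def vec_eq_iff sum.distrib sum_distrib_left
        algebra_simps)
  then show ?thesis by (simp add: bilinear_conv_bounded_bilinear)
qed

interpretation matrix_mult: bounded_bilinear "(**) :: ('n::finite) sqmat \<Rightarrow> 'n sqmat \<Rightarrow> 'n sqmat"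
  by (rule bounded_bilinear_matrix_mult)

lemma bounded_linear_transpose:
  "bounded_linear (transpose :: ('n::finite) sqmat \<Rightarrow> 'n sqmat)"
  unfolding linear_conv_bounded_linear[symmetric]
  by (intro linearI) (simp_all add: transpose_def vec_eq_iff)

section \<open>Rotations and tangency of the Killing fields\<close>

lemma grassmann_conj:
  assumes Q: "orthogonal_matrix Q" and X: "X \<in> grassmann r"
  shows "Q ** X ** transpose Q \<in> grassmann r"
proof -
  have q: "transpose Q ** Q = mat 1" using Q by (simp add: orthogonal_matrix)
  have x: "transpose X = X" "X ** X = X" "trace X = real r" using X by (auto simp: grassmann_def)
  have "(Q ** X ** transpose Q) ** (Q ** X ** transpose Q)
      = Q ** X ** (transpose Q ** Q) ** X ** transpose Q"
    by (simp add: matrix_mul_assoc)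
  also have "\<dots> = Q ** (X ** X) ** transpose Q"
    by (simp add: q matrix_mul_assoc)
  finally have "(Q ** X ** transpose Q) ** (Q ** X ** transpose Q) = Q ** X ** transpose Q"
    using x by simp
  moreover have "trace (Q ** X ** transpose Q) = real r"
    using trace_mul_sym[of "Q ** X" "transpose Q"] q x by (simp add: matrix_mul_assoc)
  ultimately show ?thesis
    using x by (simp add: grassmann_def matrix_transpose_mul matrix_mul_assoc)
qed

text \<open>The matrix is \<open>exp (t J)\<close>, whose power series collapses because \<open>J\<^sup>3 = -J\<close>.\<close>

lemma orthogonal_rotation:
  fixes J :: "('n::finite) sqmat"
  assumes J: "transpose J = - J" and J3: "J ** J ** J = - J"
  shows "orthogonal_matrix (mat 1 + sin t *\<^sub>R J + (1 - cos t) *\<^sub>R (J ** J))"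
    (is "orthogonal_matrix ?Q")
proof -
  have T: "transpose ?Q = mat 1 - sin t *\<^sub>R J + (1 - cos t) *\<^sub>R (J ** J)"
    using bounded_linear.linear[OF bounded_linear_transpose[where 'n='n]]
    by (simp add: linear_add linear_scale matrix_transpose_mul J matrix_mult.minus_left matrix_mult.minus_right)
  have J4: "J ** (J ** J) = - J" "J ** J ** (J ** J) = - (J ** J)"
    using J3 by (simp_all add: matrix_mul_assoc matrix_mult.minus_left)
  \<comment> \<open>Since the fourth power of \<open>J\<close> is \<open>- (J ** J)\<close>, the
    product \<open>transpose ?Q ** ?Q\<close> differs from the identity by
    \<open>1 - cos\<^sup>2 t - sin\<^sup>2 t\<close> times \<open>J ** J\<close>.\<close>
  have "(cos t * cos t) *\<^sub>R (J ** J) + (sin t * sin t) *\<^sub>R (J ** J) = J ** J"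
    using sin_cos_squared_add2[of t] by (simp add: scaleR_left_distrib[symmetric] power2_eq_square)
  then have "transpose ?Q ** ?Q = mat 1"
    unfolding T
    by (simp add: matrix_mult.add_left matrix_mult.add_right matrix_mult.diff_left matrix_mult.diff_right
        matrix_mult.scaleR_left matrix_mult.scaleR_right J3 J4 algebra_simps)
  then show ?thesis by (simp add: orthogonal_matrix)
qed

text \<open>With \<open>Q t\<close> the exponential of \<open>t\<close> times
  \<open>skew_unit i j\<close>, conjugation of \<open>X\<close> by \<open>Q t\<close> stays in the
  Grassmannian, and its velocity at 0 is the commutator of \<open>skew_unit i j\<close> with
  \<open>X\<close>.\<close>

lemma killing_field_tangent:
  assumes "i \<noteq> j" and X: "X \<in> grassmann r"
  shows "killing_field i j X \<in> tangent_space (grassmann r) X"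
proof -
  define J where "J = mat_unit i j - mat_unit j i"
  \<comment> \<open>The angular speed \<open>c\<close> makes \<open>c\<close> times \<open>J\<close>
    equal to \<open>skew_unit i j\<close>.\<close>
  define c :: real where "c = sqrt 2 / 2"
  define Q where "Q t = mat 1 + sin (c * t) *\<^sub>R J + (1 - cos (c * t)) *\<^sub>R (J ** J)" for t
  define Q' where "Q' t = (c * cos (c * t)) *\<^sub>R J + (c * sin (c * t)) *\<^sub>R (J ** J)" for t
  have lin: "linear (transpose :: 'a sqmat \<Rightarrow> _)"
    using bounded_linear_transpose by (rule bounded_linear.linear)
  have JT: "transpose J = - J"
    by (simp add: J_def linear_diff[OF lin] transpose_mat_unit)
  \<comment> \<open>For distinct indices \<open>J ** J\<close> is minus the projection onto the
    plane of coordinates \<open>i\<close> and \<open>j\<close>.\<close>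
  have "J ** J ** J = - J"
    using \<open>i \<noteq> j\<close>
    by (simp add: J_def matrix_mult.diff_left matrix_mult.diff_right mat_unit_mult_mat_unit
        matrix_mult.zero_left matrix_mult.minus_left)
  from orthogonal_rotation[OF JT this] have orth: "orthogonal_matrix (Q t)" for t
    by (simp add: Q_def)
  define \<gamma> where "\<gamma> t = Q t ** X ** transpose (Q t)" for t
  define \<gamma>' where "\<gamma>' t = Q t ** X ** transpose (Q' t) + Q' t ** X ** transpose (Q t)" for t
  have dQ: "(Q has_vector_derivative Q' t) (at t)" for t
    unfolding Q_def Q'_def
    by (auto simp: has_vector_derivative_def algebra_simps intro!: derivative_eq_intros)
  have d: "(\<gamma> has_vector_derivative \<gamma>' t) (at t)" for t
  proof -
    have 1: "((\<lambda>t. transpose (Q t)) has_vector_derivative transpose (Q' t)) (at t)"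
      using dQ by (rule bounded_linear.has_vector_derivative[OF bounded_linear_transpose])
    have 2: "((\<lambda>t. Q t ** X) has_vector_derivative Q' t ** X) (at t)"
      using dQ by (rule bounded_linear.has_vector_derivative[OF matrix_mult.bounded_linear_left])
    show ?thesis unfolding \<gamma>_def \<gamma>'_def
      by (rule matrix_mult.has_vector_derivative[OF 2 1])
  qed
  have cont: "continuous_on UNIV \<gamma>'"
    unfolding \<gamma>'_def Q_def Q'_def
    by (intro continuous_intros matrix_mult.continuous_on bounded_linear.continuous_on[OF bounded_linear_transpose])
  have g0: "\<gamma> 0 = X"
    by (simp add: \<gamma>_def Q_def)
  have "\<gamma>' 0 = killing_field i j X"
    by (simp add: \<gamma>'_def Q_def Q'_def killing_field_def skew_unit_def J_def[symmetric] c_def[symmetric]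
        linear_scale[OF lin] JT matrix_mult.minus_right matrix_mult.scaleR_left matrix_mult.scaleR_right)
  moreover have "\<gamma> t \<in> grassmann r" for t
    unfolding \<gamma>_def using orth X by (rule grassmann_conj)
  moreover have "\<gamma> C1_differentiable_on {-1<..<1}"
    unfolding C1_differentiable_on_def
    using d continuous_on_subset[OF cont] by (intro exI[of _ \<gamma>']) simp
  ultimately show ?thesis
    unfolding tangent_space_def using d[of 0] g0
    by (auto intro!: exI[of _ \<gamma>] exI[of _ 1])
qed

section \<open>Parseval's identity on skew matrices\<close>

text \<open>Swapping the indices matches the lower triangle with the upper one. Sums over
  \<open>i < j\<close> thus become full double sums, which are inner products and traces.\<close>

lemma sum_less_symmetric:
  fixes f :: "'n::{finite,linorder} \<Rightarrow> 'n \<Rightarrow> real"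
  assumes "\<And>i j. f i j = f j i"
  shows "2 * (\<Sum>(i, j) | i < j. f i j) = (\<Sum>i\<in>UNIV. \<Sum>j\<in>UNIV. f i j) - (\<Sum>i\<in>UNIV. f i i)"
proof -
  have gt: "(\<Sum>(i, j) | j < i. f i j) = (\<Sum>(i, j) | i < j. f i j)"
    using assms by (intro sum.reindex_bij_witness[of _ prod.swap prod.swap]) auto
  have eq: "(\<Sum>(i, j) | i = j. f i j) = (\<Sum>i\<in>UNIV. f i i)"
    by (rule sum.reindex_bij_witness[of _ "\<lambda>i. (i, i)" fst]) auto
  have U: "(UNIV :: ('n \<times> 'n) set) = {(i, j). i < j} \<union> {(i, j). j < i} \<union> {(i, j). i = j}"
    by auto
  have "(\<Sum>i\<in>UNIV. \<Sum>j\<in>UNIV. f i j) = (\<Sum>(i, j)\<in>UNIV. f i j)"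
    by (simp add: sum.cartesian_product)
  also have "\<dots> = (\<Sum>(i, j)\<in>{(i, j). i < j} \<union> {(i, j). j < i}. f i j) + (\<Sum>(i, j) | i = j. f i j)"
    unfolding U by (rule sum.union_disjoint) auto
  also have "(\<Sum>(i, j)\<in>{(i, j). i < j} \<union> {(i, j). j < i}. f i j)
      = (\<Sum>(i, j) | i < j. f i j) + (\<Sum>(i, j) | j < i. f i j)"
    by (rule sum.union_disjoint) auto
  finally show ?thesis using gt eq by simp
qed

text \<open>Parseval's identity: for skew \<open>A\<close> the coefficient along
  \<open>skew_unit i j\<close> is \<open>sqrt 2 * A $ i $ j\<close>, so each term is twice a product
  of entries, and the diagonal vanishes.\<close>

lemma sum_inner_skew_unit:
  fixes A B :: "('n::{finite,linorder}) sqmat"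
  assumes A: "transpose A = - A" and B: "transpose B = - B"
  shows "(\<Sum>(i, j) | i < j. (A \<bullet> skew_unit i j) * (B \<bullet> skew_unit i j)) = A \<bullet> B"
proof -
  have s: "A $ j $ i = - A $ i $ j" "B $ j $ i = - B $ i $ j" for i j
    using arg_cong[OF A, of "\<lambda>M. M $ i $ j"] arg_cong[OF B, of "\<lambda>M. M $ i $ j"]
    by (simp_all add: transpose_def)
  have z: "A $ i $ i = 0" for i using s(1)[of i i] by linarith
  have "(\<Sum>(i, j) | i < j. (A \<bullet> skew_unit i j) * (B \<bullet> skew_unit i j))
      = 2 * (\<Sum>(i, j) | i < j. A $ i $ j * B $ i $ j)"
    unfolding sum_distrib_left
  proof (intro sum.cong refl, clarify)
    fix i j
    show "(A \<bullet> skew_unit i j) * (B \<bullet> skew_unit i j) = 2 * (A $ i $ j * B $ i $ j)"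
      unfolding inner_skew_unit using s[where i = i and j = j] by (simp add: algebra_simps)
  qed
  also have "\<dots> = (\<Sum>i\<in>UNIV. \<Sum>j\<in>UNIV. A $ i $ j * B $ i $ j) - (\<Sum>i\<in>UNIV. A $ i $ i * B $ i $ i)"
  proof (rule sum_less_symmetric)
    show "A $ i $ j * B $ i $ j = A $ j $ i * B $ j $ i" for i j
      using s[of i j] by simp
  qed
  also have "\<dots> = A \<bullet> B" by (simp add: z inner_vec_def)
  finally show ?thesis .
qed

lemma inner_matrix_mult_left:
  fixes A B C :: "('n::finite) sqmat"
  shows "A \<bullet> (B ** C) = (transpose B ** A) \<bullet> C"
  unfolding frob_inner_eq_inner[symmetric] frob_inner_def
  by (simp add: matrix_transpose_mul matrix_mul_assoc)

lemma inner_matrix_mult_right: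
  fixes A B C :: "('n::finite) sqmat"
  shows "A \<bullet> (B ** C) = (A ** transpose C) \<bullet> B"
  unfolding frob_inner_eq_inner[symmetric] frob_inner_def
  using trace_mul_sym[of "transpose A ** B" C] by (simp add: matrix_transpose_mul matrix_mul_assoc)

text \<open>Left and right multiplication by a symmetric \<open>X\<close> are self-adjoint. Moving
  them onto \<open>G\<close> leaves the indices only in the basis vector
  \<open>skew_unit i j\<close>.\<close>

lemma inner_killing_field:
  assumes "transpose X = X"
  shows "G \<bullet> killing_field i j X = (G ** X - X ** G) \<bullet> skew_unit i j"
  unfolding killing_field_def inner_diff_right inner_diff_left
  using assms by (simp add: inner_matrix_mult_left[of G X] inner_matrix_mult_right[of G _ X])

lemma commutator_transpose:
  fixes A B :: "('n::finite) sqmat"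
  assumes "transpose A = A" "transpose B = B"
  shows "transpose (A ** B - B ** A) = - (A ** B - B ** A)"
  using assms by (simp add: linear_diff[OF bounded_linear.linear[OF bounded_linear_transpose]] matrix_transpose_mul)

text \<open>Commutators of symmetric matrices are skew, so Parseval's identity applies. It serves
  both the gradient term and the second-order radial term.\<close>

lemma sum_inner_killing_field:
  fixes X Y :: "('n::{finite,linorder}) sqmat"
  assumes "transpose X = X" "transpose Y = Y" "transpose G = G" "transpose H = H"
  shows "(\<Sum>(i, j) | i < j. (G \<bullet> killing_field i j X) * (H \<bullet> killing_field i j Y))
    = (G ** X - X ** G) \<bullet> (H ** Y - Y ** H)"
  unfolding inner_killing_field[OF assms(1)] inner_killing_field[OF assms(2)]
  by (rule sum_inner_skew_unit; intro commutator_transpose assms)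

lemma symmetric_mat_nth: "transpose A = A \<Longrightarrow> A $ j $ i = A $ i $ j"
  by (drule arg_cong[where f = "\<lambda>M. M $ i $ j"]) (simp add: transpose_def)

section \<open>Inner products of Killing fields\<close>

text \<open>By \<open>inner_killing_field\<close> the left side is the coefficient along
  \<open>skew_unit i j\<close> of the commutator of \<open>killing_field i j X\<close> with
  \<open>Y\<close>, which is read off from two of its entries.\<close>

lemma inner_killing_fields:
  assumes "transpose X = X" "transpose Y = Y" "i \<noteq> j"
  shows "killing_field i j X \<bullet> killing_field i j Y =
    (X ** Y) $ i $ i + (X ** Y) $ j $ j - X $ i $ i * Y $ j $ j - X $ j $ j * Y $ i $ i
      + 2 * (X $ i $ j * Y $ i $ j)"
proof -
  have "(Y ** X) $ k $ k = (X ** Y) $ k $ k" for k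
    using arg_cong[OF matrix_transpose_mul[of X Y], of "\<lambda>M. M $ k $ k"] assms
    by (simp add: transpose_def[of "X ** Y"])
  moreover have "X $ j $ i = X $ i $ j" "Y $ j $ i = Y $ i $ j"
    using assms by (simp_all add: symmetric_mat_nth[of _ j i])
  \<comment> \<open>The sandwiched matrix unit is the outer product of column \<open>k\<close> of
    \<open>A\<close> and row \<open>l\<close> of \<open>B\<close>.\<close>
  moreover have "(A ** mat_unit k l ** B) $ m $ n = A $ m $ k * B $ l $ n" for A B :: "'a sqmat" and k l m n
  proof -
    have "(A ** mat_unit k l ** B) $ m $ n = (\<Sum>a\<in>UNIV. if a = l then A $ m $ k * B $ l $ n else 0)"
      unfolding matrix_matrix_mult_def[of "A ** mat_unit k l"] vec_lambda_beta
        by (intro sum.cong refl) auto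
    then show ?thesis by simp
  qed
  moreover have sq: "sqrt 2 * (sqrt 2 * x) = 2 * x" for x :: real
    by (simp flip: mult.assoc)
  ultimately show ?thesis
    unfolding inner_killing_field[OF assms(2)] inner_skew_unit
    using \<open>i \<noteq> j\<close>
    by (simp add: killing_field_def skew_unit_def matrix_mult.diff_left matrix_mult.diff_right
        matrix_mult.scaleR_left matrix_mult.scaleR_right matrix_mul_assoc)
      (simp add: sq matrix_mul_assoc[symmetric] field_simps)
qed

lemma sum_inner_killing_fields:
  fixes X Y :: "('n::{finite,linorder}) sqmat"
  assumes "transpose X = X" "transpose Y = Y"
  shows "(\<Sum>(i, j) | i < j. killing_field i j X \<bullet> killing_field i j Y)
    = real CARD('n) * (X \<bullet> Y) - trace X * trace Y"
proof -
  \<comment> \<open>On the diagonal \<open>f\<close> is not the inner product, which is zero there.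
    Its diagonal sum is subtracted through \<open>sum_less_symmetric\<close> and cancels the surplus
    \<open>2 * (X \<bullet> Y)\<close> of the double sum.\<close>
  define f where "f i j = (X ** Y) $ i $ i + (X ** Y) $ j $ j - X $ i $ i * Y $ j $ j - X $ j $ j * Y $ i $ i
      + 2 * (X $ i $ j * Y $ i $ j)" for i j
  have "X $ j $ i = X $ i $ j" "Y $ j $ i = Y $ i $ j" for i j
    using assms by (simp_all add: symmetric_mat_nth[of _ j i])
  then have sym: "f i j = f j i" for i j
    by (simp add: f_def)
  have tr: "(\<Sum>i\<in>UNIV. (X ** Y) $ i $ i) = X \<bullet> Y"
    using assms unfolding frob_inner_eq_inner[symmetric] by (simp add: frob_inner_def trace_def)
  have "(\<Sum>(i, j) | i < j. killing_field i j X \<bullet> killing_field i j Y) = (\<Sum>(i, j) | i < j. f i j)"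
    using assms by (intro sum.cong) (auto simp: f_def inner_killing_fields)
  moreover have "(\<Sum>i\<in>UNIV. f i i) = 2 * (X \<bullet> Y)"
    by (simp add: f_def sum.distrib tr algebra_simps sum_distrib_left[symmetric])
  moreover have "(\<Sum>i\<in>UNIV. \<Sum>j\<in>UNIV. f i j)
      = 2 * real CARD('n) * (X \<bullet> Y) - 2 * (trace X * trace Y) + 2 * (X \<bullet> Y)"
  proof -
    have "(\<Sum>i\<in>UNIV. \<Sum>j\<in>UNIV. X $ j $ j * Y $ i $ i) = trace X * trace Y"
      unfolding trace_def sum_product by (rule sum.swap)
    moreover have "(\<Sum>i\<in>UNIV. \<Sum>j\<in>UNIV. X $ i $ i * Y $ j $ j) = trace X * trace Y"
      unfolding trace_def sum_product ..
    moreover have "(\<Sum>i\<in>UNIV. \<Sum>j\<in>UNIV. X $ i $ j * Y $ i $ j) = X \<bullet> Y"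
      by (simp add: inner_vec_def)
    moreover have "(\<Sum>i\<in>(UNIV::'n set). \<Sum>j\<in>UNIV. (X ** Y) $ j $ j) = real CARD('n) * (X \<bullet> Y)"
      "(\<Sum>i\<in>UNIV. \<Sum>j\<in>(UNIV::'n set). (X ** Y) $ i $ i) = real CARD('n) * (X \<bullet> Y)"
      by (simp_all add: tr sum_distrib_left[symmetric])
    ultimately show ?thesis
      unfolding f_def by (simp add: sum.distrib sum_subtractf sum_distrib_left[symmetric] del: sum_constant)
  qed
  ultimately show ?thesis
    using sum_less_symmetric[of f, OF sym] by simp
qed

section \<open>Radial kernels\<close>

text \<open>The coefficient of \<open>X\<close> along its own Killing field comes from the
  commutator of \<open>X\<close> with itself; geometrically, conjugation by rotations preserves the
  norm.\<close>

lemma killing_field_orthogonal: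
  assumes "transpose X = X"
  shows "X \<bullet> killing_field i j X = 0"
  using inner_killing_field[OF assms, of X] by simp

text \<open>The squared norm is smooth even at \<open>Z = C\<close> and takes values in
  \<open>{0..}\<close>, so the chain rule within \<open>{0..}\<close> works with the one-sided
  derivative of \<psi> at 0.\<close>

lemma has_derivative_compose_norm_sq:
  fixes \<psi> :: "real \<Rightarrow> real" and C :: "'a::real_inner"
  assumes "\<forall>s\<ge>0. (\<psi> has_real_derivative \<psi>' s) (at s within {0..})" and "Z \<in> M"
  shows "((\<lambda>Z. \<psi> ((norm (Z - C))\<^sup>2)) has_derivative
           (\<lambda>V. \<psi>' ((norm (Z - C))\<^sup>2) * (2 * ((Z - C) \<bullet> V)))) (at Z within M)"
proof (rule has_derivative_in_compose2[where t = "{0..}" and g = \<psi> and g' = "\<lambda>s h. \<psi>' s * h"])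
  show "(\<psi> has_derivative (*) (\<psi>' s)) (at s within {0..})" if "s \<in> {0..}" for s
    using assms that by (simp add: has_field_derivative_def)
  show "((\<lambda>Z. (norm (Z - C))\<^sup>2) has_derivative (\<lambda>V. 2 * ((Z - C) \<bullet> V))) (at Z within M)"
    unfolding power2_norm_eq_inner
    by (auto intro!: derivative_eq_intros simp: inner_commute)
qed (use assms in auto)

lemma killing_mixed_radial:
  fixes \<kappa> :: "('n::finite) sqmat \<Rightarrow> 'n sqmat \<Rightarrow> real"
  assumes \<psi>: "\<forall>s\<ge>0. (\<psi> has_real_derivative \<psi>' s) (at s within {0..})"
    and \<psi>': "\<forall>s\<ge>0. (\<psi>' has_real_derivative \<psi>'' s) (at s within {0..})"
    and \<kappa>: "\<forall>U \<in> grassmann r. \<forall>V \<in> grassmann r. \<kappa> U V = exp (- \<psi> ((norm (U - V))\<^sup>2))"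
    and X: "X \<in> grassmann r" and Y: "Y \<in> grassmann r" and "i \<noteq> j"
  shows "killing_mixed r i j \<kappa> X Y =
    2 * \<psi>' ((norm (X - Y))\<^sup>2) * (killing_field i j X \<bullet> killing_field i j Y)
      - 4 * \<psi>'' ((norm (X - Y))\<^sup>2) * ((Y \<bullet> killing_field i j X) * (X \<bullet> killing_field i j Y))"
proof -
  let ?M = "grassmann r :: 'n sqmat set" and ?K = "killing_field i j"
  have sym: "transpose X = X" "transpose Y = Y" using X Y by (auto simp: grassmann_def)
  \<comment> \<open>Orthogonality of \<open>X\<close> to its Killing field removes the
    \<open>X\<close> part of \<open>X - W\<close>, and the two minus signs cancel.\<close>
  have first: "killing_deriv r i j (\<lambda>Z. ln (\<kappa> Z W)) X = \<psi>' ((norm (W - X))\<^sup>2) * (2 * (W \<bullet> ?K X))"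
    if W: "W \<in> ?M" for W
  proof -
    have "((\<lambda>Z. - \<psi> ((norm (Z - W))\<^sup>2)) has_derivative
        (\<lambda>V. - (\<psi>' ((norm (X - W))\<^sup>2) * (2 * ((X - W) \<bullet> V))))) (at X within ?M)"
      by (intro has_derivative_minus has_derivative_compose_norm_sq \<psi> X)
    then have "((\<lambda>Z. ln (\<kappa> Z W)) has_derivative
        (\<lambda>V. - (\<psi>' ((norm (X - W))\<^sup>2) * (2 * ((X - W) \<bullet> V))))) (at X within ?M)"
      by (rule has_derivative_transform[rotated 2]) (use W X \<kappa> in auto)
    from has_tangent_deriv[OF this killing_field_tangent[OF \<open>i \<noteq> j\<close> X]] show ?thesis
      by (simp add: killing_deriv_def inner_diff_left killing_field_orthogonal sym norm_minus_commute)
  qed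
  \<comment> \<open>Product rule in \<open>W\<close>. At \<open>V = ?K Y\<close> the factor
    \<open>(Y - X) \<bullet> V\<close> reduces to \<open>- (X \<bullet> V)\<close>, the source of
    the minus sign before \<psi>''.\<close>
  have "((\<lambda>W. \<psi>' ((norm (W - X))\<^sup>2) * (2 * (W \<bullet> ?K X))) has_derivative
      (\<lambda>V. \<psi>' ((norm (Y - X))\<^sup>2) * (2 * (V \<bullet> ?K X)) +
        \<psi>'' ((norm (Y - X))\<^sup>2) * (2 * ((Y - X) \<bullet> V)) * (2 * (Y \<bullet> ?K X)))) (at Y within ?M)"
    by (rule has_derivative_mult[OF has_derivative_compose_norm_sq[OF \<psi>' Y]])
      (auto intro!: derivative_eq_intros)
  \<comment> \<open>The formula for the inner derivative holds for \<open>W\<close> in the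
    Grassmannian, which suffices for a derivative within it.\<close>
  then have "((\<lambda>W. killing_deriv r i j (\<lambda>Z. ln (\<kappa> Z W)) X) has_derivative
      (\<lambda>V. \<psi>' ((norm (Y - X))\<^sup>2) * (2 * (V \<bullet> ?K X)) +
        \<psi>'' ((norm (Y - X))\<^sup>2) * (2 * ((Y - X) \<bullet> V)) * (2 * (Y \<bullet> ?K X)))) (at Y within ?M)"
    by (rule has_derivative_transform[rotated 2]) (use Y first in auto)
  from has_tangent_deriv[OF this killing_field_tangent[OF \<open>i \<noteq> j\<close> Y]] show ?thesis
    unfolding killing_mixed_def killing_deriv_def[of r i j _ Y]
    by (simp add: inner_diff_left killing_field_orthogonal sym norm_minus_commute inner_commute algebra_simps)
qed

lemma sum_killing_mixed_radial:
  fixes \<kappa> :: "('n::{finite,linorder}) sqmat \<Rightarrow> 'n sqmat \<Rightarrow> real"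
  assumes \<psi>: "\<forall>s\<ge>0. (\<psi> has_real_derivative \<psi>' s) (at s within {0..})"
    and \<psi>': "\<forall>s\<ge>0. (\<psi>' has_real_derivative \<psi>'' s) (at s within {0..})"
    and \<kappa>: "\<forall>U \<in> grassmann r. \<forall>V \<in> grassmann r. \<kappa> U V = exp (- \<psi> ((norm (U - V))\<^sup>2))"
    and X: "X \<in> grassmann r" and Y: "Y \<in> grassmann r"
  shows "(\<Sum>(i, j) | i < j. killing_mixed r i j \<kappa> X Y) =
    2 * \<psi>' ((norm (X - Y))\<^sup>2) * (real CARD('n) * (X \<bullet> Y) - (real r)\<^sup>2)
      + 4 * \<psi>'' ((norm (X - Y))\<^sup>2) * (norm (X ** Y - Y ** X))\<^sup>2"
proof -
  let ?s = "(norm (X - Y))\<^sup>2"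
  have x: "transpose X = X" "transpose Y = Y" "trace X = real r" "trace Y = real r"
    using X Y by (auto simp: grassmann_def)
  have "(\<Sum>(i, j) | i < j. killing_mixed r i j \<kappa> X Y)
      = (\<Sum>(i, j) | i < j. 2 * \<psi>' ?s * (killing_field i j X \<bullet> killing_field i j Y)
          - 4 * \<psi>'' ?s * ((Y \<bullet> killing_field i j X) * (X \<bullet> killing_field i j Y)))"
    by (intro sum.cong) (auto intro!: killing_mixed_radial[OF \<psi> \<psi>' \<kappa> X Y])
  also have "\<dots> = 2 * \<psi>' ?s * (\<Sum>(i, j) | i < j. killing_field i j X \<bullet> killing_field i j Y)
      - 4 * \<psi>'' ?s * (\<Sum>(i, j) | i < j. (Y \<bullet> killing_field i j X) * (X \<bullet> killing_field i j Y))"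
    by (simp add: case_prod_unfold sum_subtractf sum_distrib_left)
  \<comment> \<open>Parseval's identity is applied with \<open>Y\<close> in place of the gradient at
    \<open>X\<close>, and \<open>X\<close> in place of the gradient at \<open>Y\<close>.\<close>
  also have "\<dots> = 2 * \<psi>' ?s * (real CARD('n) * (X \<bullet> Y) - (real r)\<^sup>2)
      - 4 * \<psi>'' ?s * ((Y ** X - X ** Y) \<bullet> (X ** Y - Y ** X))"
    by (simp add: sum_inner_killing_fields sum_inner_killing_field x power2_eq_square)
  \<comment> \<open>The two commutators are opposite, which turns the minus before \<psi>'' into a
    plus.\<close>
  also have "(Y ** X - X ** Y) \<bullet> (X ** Y - Y ** X) = - (norm (X ** Y - Y ** X))\<^sup>2"
    by (metis inner_minus_left minus_diff_eq power2_norm_eq_inner)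
  finally show ?thesis by simp
qed

section \<open>The gradient formula and the theorem\<close>

text \<open>Killing fields are tangent, so each Killing derivative is a pairing with
  \<open>G\<close> or \<open>H\<close>. Symmetry of the gradients makes their commutators with
  \<open>X\<close> and \<open>Y\<close> skew, as Parseval's identity requires.\<close>

lemma kappa_p_gradients:
  fixes X Y :: "('n::{finite,linorder}) sqmat"
  assumes X: "X \<in> grassmann r" and Y: "Y \<in> grassmann r"
    and G: "symmetric_mat G" "euclidean_gradient (grassmann r) (log_dens r p (\<lambda>Z. \<kappa> Z Y) X) X G"
    and H: "symmetric_mat H" "euclidean_gradient (grassmann r) (log_dens r p (\<lambda>Z. \<kappa> X Z) Y) Y H"
  shows "kappa_p r p \<kappa> X Y =
    4 * frob_inner (skew_part (G ** X)) (skew_part (H ** Y)) * \<kappa> X Y +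
    (\<Sum>(i, j) | i < j. killing_mixed r i j \<kappa> X Y) * \<kappa> X Y"
proof -
  have x: "transpose X = X" "transpose Y = Y" "transpose G = G" "transpose H = H"
    using X Y G H by (auto simp: grassmann_def symmetric_mat_def)
  have "kappa_p r p \<kappa> X Y = \<kappa> X Y * (\<Sum>(i, j) | i < j.
      (G \<bullet> killing_field i j X) * (H \<bullet> killing_field i j Y) + killing_mixed r i j \<kappa> X Y)"
    unfolding kappa_p_def
  proof (intro arg_cong[where f = "(*) (\<kappa> X Y)"] sum.cong refl, clarify)
    fix i j :: 'n assume "i < j"
    then show "killing_deriv r i j (log_dens r p (\<lambda>Z. \<kappa> Z Y) X) X *
        killing_deriv r i j (log_dens r p (\<lambda>Z. \<kappa> X Z) Y) Y + killing_mixed r i j \<kappa> X Y =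
      (G \<bullet> killing_field i j X) * (H \<bullet> killing_field i j Y) + killing_mixed r i j \<kappa> X Y"
      using G(2) H(2) killing_field_tangent[of i j] X Y
      by (simp add: killing_deriv_def euclidean_gradient_def frob_inner_eq_inner)
  qed
  also have "\<dots> = \<kappa> X Y * ((G ** X - X ** G) \<bullet> (H ** Y - Y ** H)
      + (\<Sum>(i, j) | i < j. killing_mixed r i j \<kappa> X Y))"
    by (simp add: case_prod_unfold sum.distrib
        sum_inner_killing_field[OF x, unfolded case_prod_unfold])
  \<comment> \<open>By symmetry \<open>X ** G\<close> is the transpose of \<open>G ** X\<close>, so
    each commutator is twice a \<open>skew_part\<close>; hence the factor 4.\<close>
  also have "(G ** X - X ** G) \<bullet> (H ** Y - Y ** H)
      = 4 * frob_inner (skew_part (G ** X)) (skew_part (H ** Y))"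
    by (simp add: frob_inner_eq_inner skew_part_def matrix_transpose_mul x)
  finally show ?thesis by (simp add: algebra_simps)
qed

theorem theorem5p4:
  fixes r :: nat
    and \<mu> :: "('n::{finite,linorder}) sqmat measure"
    and p :: "'n sqmat \<Rightarrow> real"
    and \<kappa> :: "'n sqmat \<Rightarrow> 'n sqmat \<Rightarrow> real"
  assumes "1 \<le> r" and "r \<le> CARD('n)"
    and "grassmann_volume r \<mu>"
    and "\<forall>X \<in> grassmann r. p X > 0"
    and "locally_lipschitz_on (grassmann r) p"
    and "(\<integral>\<^sup>+X. ennreal (p X) \<partial>\<mu>) = 1"
    and "kernel_on (grassmann r) \<kappa>"
    and "\<forall>X \<in> grassmann r. \<forall>Y \<in> grassmann r. \<kappa> X Y > 0"
    and "C11_on (grassmann r) \<kappa>"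
  shows "\<forall>X \<in> grassmann r. \<forall>Y \<in> grassmann r. \<forall>G H.
      symmetric_mat G \<and> euclidean_gradient (grassmann r) (log_dens r p (\<lambda>Z. \<kappa> Z Y) X) X G \<and>
      symmetric_mat H \<and> euclidean_gradient (grassmann r) (log_dens r p (\<lambda>Z. \<kappa> X Z) Y) Y H \<longrightarrow>
      kappa_p r p \<kappa> X Y =
        4 * frob_inner (skew_part (G ** X)) (skew_part (H ** Y)) * \<kappa> X Y +
        (\<Sum>(i, j) | i < j. killing_mixed r i j \<kappa> X Y * \<kappa> X Y) \<and>
      (\<forall>\<psi> \<psi>' \<psi>'' :: real \<Rightarrow> real.
        (\<forall>s\<ge>0. (\<psi> has_real_derivative \<psi>' s) (at s within {0..})) \<and>
        (\<forall>s\<ge>0. (\<psi>' has_real_derivative \<psi>'' s) (at s within {0..})) \<and>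
        continuous_on {0..} \<psi>'' \<and>
        (\<forall>U \<in> grassmann r. \<forall>V \<in> grassmann r. \<kappa> U V = exp (- \<psi> ((frob_norm (U - V))\<^sup>2))) \<longrightarrow>
        kappa_p r p \<kappa> X Y =
          4 * frob_inner (skew_part (G ** X)) (skew_part (H ** Y)) * \<kappa> X Y +
          2 * \<psi>' ((frob_norm (X - Y))\<^sup>2) *
            (real CARD('n) * frob_inner X Y - (real r)\<^sup>2) * \<kappa> X Y +
          4 * \<psi>'' ((frob_norm (X - Y))\<^sup>2) * (frob_norm (X ** Y - Y ** X))\<^sup>2 * \<kappa> X Y)"
proof (intro ballI allI impI, elim conjE, intro conjI allI impI; (elim conjE)?)
  fix X Y G H :: "'n sqmat"
  assume X: "X \<in> grassmann r" and Y: "Y \<in> grassmann r"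
    and G: "symmetric_mat G" "euclidean_gradient (grassmann r) (log_dens r p (\<lambda>Z. \<kappa> Z Y) X) X G"
    and H: "symmetric_mat H" "euclidean_gradient (grassmann r) (log_dens r p (\<lambda>Z. \<kappa> X Z) Y) Y H"
  note main = kappa_p_gradients[OF X Y G H]
  then show "kappa_p r p \<kappa> X Y =
      4 * frob_inner (skew_part (G ** X)) (skew_part (H ** Y)) * \<kappa> X Y +
      (\<Sum>(i, j) | i < j. killing_mixed r i j \<kappa> X Y * \<kappa> X Y)"
    by (simp add: case_prod_unfold sum_distrib_right)
  fix \<psi> \<psi>' \<psi>'' :: "real \<Rightarrow> real"
  assume "\<forall>s\<ge>0. (\<psi> has_real_derivative \<psi>' s) (at s within {0..})"
    and "\<forall>s\<ge>0. (\<psi>' has_real_derivative \<psi>'' s) (at s within {0..})"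
    and "\<forall>U \<in> grassmann r. \<forall>V \<in> grassmann r. \<kappa> U V = exp (- \<psi> ((frob_norm (U - V))\<^sup>2))"
  note mixed = sum_killing_mixed_radial[OF this[unfolded frob_norm_eq_norm] X Y]
  show "kappa_p r p \<kappa> X Y =
      4 * frob_inner (skew_part (G ** X)) (skew_part (H ** Y)) * \<kappa> X Y +
      2 * \<psi>' ((frob_norm (X - Y))\<^sup>2) *
        (real CARD('n) * frob_inner X Y - (real r)\<^sup>2) * \<kappa> X Y +
      4 * \<psi>'' ((frob_norm (X - Y))\<^sup>2) * (frob_norm (X ** Y - Y ** X))\<^sup>2 * \<kappa> X Y"
    unfolding main mixed by (simp add: frob_norm_eq_norm frob_inner_eq_inner algebra_simps)
qed

end
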